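(* An implicative-ortholattice $X$ is an implicative-orthomodular lattice if and only if every two orthogonal elements of $X$ are contained in an implicative-Boolean subalgebra of $X$.
   Context: A BE algebra is an algebra $(X,\to,1)$ such that for all $x,y,z\in X$: $x\to x=1$; $x\to 1=1$; $1\to x=x$; $x\to(y\to z)=y\to(x\to z)$. It carries the relation $x\le y$ iff $x\to y=1$. It is bounded if there is $0\in X$ with $0\le x$ for all $x\in X$; then $x^*:=x\to 0$ (so $0=1^*$) and the algebra is written $(X,\to,{}^*,1)$. It is involutive if $x^{**}=x$ for all $x$, and implicative if $(x\to y)\to x=x$ for all $x,y$. An implicative-ortholattice is an implicative involutive (bounded) BE algebra. Put $x\wedge_Q y:=((x^*\to y^* )\to y^* )^*$. An implicative-orthomodular lattice is an implicative-ortholattice with $x\wedge_Q(y\to x)=x$ for all $x,y$. An implicative-Boolean algebra is an implicative-ortholattice with $(y^*\to x)\to y=x\to y$ for all $x,y$. An implicative-Boolean subalgebra of $X$ is a subset containing $0,1$ and closed under $\to$ (hence under $^*$) which is an implicative-Boolean algebra under the restricted operations. Elements $x,y$ are orthogonal, $x\perp y$, iff $x^*=x\to y$. *)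

theory Defs
  imports Main
begin

text \<open>
  All structures are carrier-based, so that a subalgebra is a structure of the same kind on a
  smaller carrier with literally the same \<open>imp\<close>, \<open>one\<close> and \<open>zero\<close>.
\<close>

definition be_le :: "('a \<Rightarrow> 'a \<Rightarrow> 'a) \<Rightarrow> 'a \<Rightarrow> 'a \<Rightarrow> 'a \<Rightarrow> bool" where
  "be_le imp one x y \<longleftrightarrow> imp x y = one"

definition be_star :: "('a \<Rightarrow> 'a \<Rightarrow> 'a) \<Rightarrow> 'a \<Rightarrow> 'a \<Rightarrow> 'a" where
  "be_star imp zero x = imp x zero"

definition be_inf_Q :: "('a \<Rightarrow> 'a \<Rightarrow> 'a) \<Rightarrow> 'a \<Rightarrow> 'a \<Rightarrow> 'a \<Rightarrow> 'a" where
  "be_inf_Q imp zero x y =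
     be_star imp zero (imp (imp (be_star imp zero x) (be_star imp zero y)) (be_star imp zero y))"

definition be_orthogonal :: "('a \<Rightarrow> 'a \<Rightarrow> 'a) \<Rightarrow> 'a \<Rightarrow> 'a \<Rightarrow> 'a \<Rightarrow> bool" where
  "be_orthogonal imp zero x y \<longleftrightarrow> be_star imp zero x = imp x y"

locale be_algebra =
  fixes X :: "'a set"
    and imp :: "'a \<Rightarrow> 'a \<Rightarrow> 'a"  (infixr "\<rightarrow>" 65)
    and one :: 'a  ("\<one>")
  assumes one_closed: "\<one> \<in> X"
    and imp_closed: "\<lbrakk>x \<in> X; y \<in> X\<rbrakk> \<Longrightarrow> x \<rightarrow> y \<in> X"
    and imp_self: "x \<in> X \<Longrightarrow> x \<rightarrow> x = \<one>"
    and imp_one: "x \<in> X \<Longrightarrow> x \<rightarrow> \<one> = \<one>"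
    and one_imp: "x \<in> X \<Longrightarrow> \<one> \<rightarrow> x = x"
    and exchange: "\<lbrakk>x \<in> X; y \<in> X; z \<in> X\<rbrakk> \<Longrightarrow> x \<rightarrow> (y \<rightarrow> z) = y \<rightarrow> (x \<rightarrow> z)"

text \<open>
  The bound is a parameter rather than an existentially quantified element. Once the algebra
  is involutive it is unique: \<open>imp zero' zero = one\<close> gives
  \<open>zero' = imp (imp zero' zero) zero = imp one zero = zero\<close>.
\<close>

locale bounded_be_algebra = be_algebra X imp one
  for X :: "'a set"
    and imp :: "'a \<Rightarrow> 'a \<Rightarrow> 'a"  (infixr "\<rightarrow>" 65)
    and one :: 'a  ("\<one>") +
  fixes zero :: 'a  ("\<zero>")
  assumes zero_closed: "\<zero> \<in> X"
    and zero_le: "x \<in> X \<Longrightarrow> be_le imp one \<zero> x"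

locale implicative_ortholattice = bounded_be_algebra +
  assumes involutive: "x \<in> X \<Longrightarrow> be_star imp zero (be_star imp zero x) = x"
    and implicative: "\<lbrakk>x \<in> X; y \<in> X\<rbrakk> \<Longrightarrow> (x \<rightarrow> y) \<rightarrow> x = x"

locale implicative_orthomodular_lattice = implicative_ortholattice +
  assumes orthomodular: "\<lbrakk>x \<in> X; y \<in> X\<rbrakk> \<Longrightarrow> be_inf_Q imp zero x (y \<rightarrow> x) = x"

locale implicative_boolean_algebra = implicative_ortholattice +
  assumes boolean: "\<lbrakk>x \<in> X; y \<in> X\<rbrakk> \<Longrightarrow> (be_star imp zero y \<rightarrow> x) \<rightarrow> y = x \<rightarrow> y"

definition implicative_boolean_subalgebra ::
    "'a set \<Rightarrow> 'a set \<Rightarrow> ('a \<Rightarrow> 'a \<Rightarrow> 'a) \<Rightarrow> 'a \<Rightarrow> 'a \<Rightarrow> bool" where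
  "implicative_boolean_subalgebra B X imp one zero \<longleftrightarrow>
     B \<subseteq> X \<and> zero \<in> B \<and> one \<in> B \<and> (\<forall>x\<in>B. \<forall>y\<in>B. imp x y \<in> B) \<and>
     implicative_boolean_algebra B imp one zero"

end

theory Submission
  imports Defs
begin

text \<open>
  In an implicative-ortholattice put \<open>x \<squnion> y = x\<^sup>* \<rightarrow> y\<close>. Contraposition makes \<open>\<squnion>\<close> commutative, the
  exchange law makes it associative, and the implicative law is exactly the absorption law
  \<open>x \<squnion> (x \<sqinter> y) = x\<close>; so \<open>(\<squnion>, \<^sup>*)\<close> is an ortholattice with \<open>x \<rightarrow> y = x\<^sup>* \<squnion> y\<close>. Its lattice order
  \<open>x \<squnion> y = y\<close> is in general stronger than \<open>x \<rightarrow> y = \<one>\<close>, and it is the lattice order that matters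
  here: \<open>x \<bottom> y\<close> says \<open>y \<squnion> x\<^sup>* = x\<^sup>*\<close>, and the orthomodularity identity of the implicative signature
  is, read through complements, the classical orthomodular law
  \<open>u \<le> v \<Longrightarrow> u \<squnion> (u\<^sup>* \<sqinter> v) = v\<close> (lemma \<open>orthomodular_iff_law\<close>).

  If orthogonal pairs lie in Boolean subalgebras and \<open>u \<le> v\<close>, then \<open>v\<^sup>*\<close> and \<open>u\<close> are orthogonal,
  and the Boolean identity for this pair is the orthomodular law for \<open>u\<close> and \<open>v\<close>.

  Conversely, orthogonal elements \<open>a, b\<close> of an orthomodular lattice together with
  \<open>c = (a \<squnion> b)\<^sup>*\<close> form an orthogonal partition of \<open>\<one>\<close>: the orthomodular law makes the
  complement of \<open>a\<close>, and that of \<open>b\<close>, the join of the other two elements. Hence sending a subset of a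
  three-element index set to the join of the corresponding elements respects complements as well
  as joins, and the image of such a map is a Boolean subalgebra (lemma \<open>boolean_range\<close>).
\<close>

context implicative_ortholattice
begin

abbreviation star :: "'a \<Rightarrow> 'a" where
  "star x \<equiv> be_star imp zero x"

definition join :: "'a \<Rightarrow> 'a \<Rightarrow> 'a"  (infixl "\<squnion>" 70) where
  "x \<squnion> y = star x \<rightarrow> y"

lemma star_closed [simp]: "x \<in> X \<Longrightarrow> star x \<in> X"
  by (simp add: be_star_def imp_closed zero_closed)

lemma join_closed [simp]: "x \<in> X \<Longrightarrow> y \<in> X \<Longrightarrow> x \<squnion> y \<in> X"
  by (simp add: join_def imp_closed)

lemma star_star [simp]: "x \<in> X \<Longrightarrow> star (star x) = x"
  by (rule involutive)

lemma star_zero [simp]: "star \<zero> = \<one>"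
  by (simp add: be_star_def imp_self zero_closed)

lemma star_one [simp]: "star \<one> = \<zero>"
  by (simp add: be_star_def one_imp zero_closed)

lemma imp_eq_join: "x \<in> X \<Longrightarrow> x \<rightarrow> y = star x \<squnion> y"
  by (simp add: join_def)

text \<open>Writing \<open>y\<close> as \<open>y\<^sup>* \<rightarrow> \<zero>\<close> turns the exchange law into contraposition.\<close>

lemma contraposition:
  assumes "x \<in> X" "y \<in> X"
  shows "x \<rightarrow> y = star y \<rightarrow> star x"
proof -
  have "x \<rightarrow> y = x \<rightarrow> (star y \<rightarrow> \<zero>)"
    using involutive[OF assms(2)] by (simp add: be_star_def)
  also have "\<dots> = star y \<rightarrow> (x \<rightarrow> \<zero>)"
    using assms by (intro exchange) (simp_all add: zero_closed)
  finally show ?thesis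
    by (simp add: be_star_def)
qed

lemma join_commute: "x \<in> X \<Longrightarrow> y \<in> X \<Longrightarrow> x \<squnion> y = y \<squnion> x"
  using contraposition[of "star x" y] by (simp add: join_def)

lemma join_left_commute:
  "x \<in> X \<Longrightarrow> y \<in> X \<Longrightarrow> z \<in> X \<Longrightarrow> x \<squnion> (y \<squnion> z) = y \<squnion> (x \<squnion> z)"
  by (simp add: join_def exchange)

lemma join_assoc:
  assumes "x \<in> X" "y \<in> X" "z \<in> X"
  shows "x \<squnion> y \<squnion> z = x \<squnion> (y \<squnion> z)"
proof -
  have "x \<squnion> y \<squnion> z = z \<squnion> (x \<squnion> y)"
    using assms by (simp add: join_commute)
  also have "\<dots> = x \<squnion> (z \<squnion> y)"
    using assms by (intro join_left_commute)
  finally show ?thesis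
    using assms by (simp add: join_commute)
qed

lemma join_idem [simp]: "x \<in> X \<Longrightarrow> x \<squnion> x = x"
  using implicative[of x \<zero>] by (simp add: join_def be_star_def zero_closed)

lemma join_left_idem [simp]: "x \<in> X \<Longrightarrow> y \<in> X \<Longrightarrow> x \<squnion> (x \<squnion> y) = x \<squnion> y"
  by (simp flip: join_assoc)

lemma zero_join [simp]: "x \<in> X \<Longrightarrow> \<zero> \<squnion> x = x"
  by (simp add: join_def one_imp)

lemma join_zero [simp]: "x \<in> X \<Longrightarrow> x \<squnion> \<zero> = x"
  using join_commute[of x \<zero>] by (simp add: zero_closed)

lemma join_star_self [simp]: "x \<in> X \<Longrightarrow> x \<squnion> star x = \<one>"
  by (simp add: join_def imp_self)

lemma star_antitone:
  assumes "u \<in> X" "v \<in> X" "u \<squnion> v = v"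
  shows "star v \<squnion> star u = star u"
  using implicative[of "star u" v] assms by (simp add: join_def)

lemma orthogonal_iff: "x \<in> X \<Longrightarrow> be_orthogonal imp zero x y \<longleftrightarrow> star x \<squnion> y = star x"
  by (auto simp: be_orthogonal_def imp_eq_join)

text \<open>
  The operation \<open>x \<sqinter>\<^sub>Q w\<close> is the Sasaki projection \<open>(x \<squnion> w\<^sup>*) \<sqinter> w\<close>, and the elements \<open>y \<rightarrow> x\<close> are
  exactly the elements above \<open>x\<close>. Complementing \<open>x \<sqinter>\<^sub>Q w = x\<close> for \<open>x \<le> w\<close> therefore yields the
  orthomodular law for \<open>w\<^sup>* \<le> x\<^sup>*\<close>.
\<close>

lemma orthomodular_iff_law:
  "implicative_orthomodular_lattice X imp one zero \<longleftrightarrow>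
    (\<forall>u\<in>X. \<forall>v\<in>X. u \<squnion> v = v \<longrightarrow> u \<squnion> star (u \<squnion> star v) = v)"
  (is "?oml \<longleftrightarrow> ?law")
proof
  assume ?oml
  show ?law
  proof (intro ballI impI)
    fix u v
    assume X: "u \<in> X" "v \<in> X" and le: "u \<squnion> v = v"
    have "u \<rightarrow> star v = star u"
      using X star_antitone[OF X le] by (simp add: imp_eq_join join_commute)
    then have "be_inf_Q imp zero (star v) (star u) = star v"
      using implicative_orthomodular_lattice.orthomodular[OF \<open>?oml\<close>, of "star v" u] X by simp
    then have "star (star (u \<squnion> star v) \<squnion> u) = star v"
      using X by (simp add: be_inf_Q_def imp_eq_join imp_closed join_commute)
    then have "star (star (star (u \<squnion> star v) \<squnion> u)) = star (star v)"
      by simp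
    then show "u \<squnion> star (u \<squnion> star v) = v"
      using X by (simp add: join_commute)
  qed
next
  assume law: ?law
  show ?oml
  proof unfold_locales
    fix x y
    assume X: "x \<in> X" "y \<in> X"
    define w where "w = y \<rightarrow> x"
    have w: "w \<in> X" "x \<squnion> w = w"
      using X join_left_commute[of x "star y" x] by (simp_all add: w_def imp_eq_join)
    have "star w \<squnion> star x = star x"
      using X w by (intro star_antitone)
    with law X w have "star w \<squnion> star (star w \<squnion> x) = star x"
      by (metis star_closed star_star)
    then have "star (star (x \<squnion> star w) \<squnion> star w) = x"
      using X w by (simp add: join_commute)
    then show "be_inf_Q imp zero x (y \<rightarrow> x) = x"
      using X w by (simp add: be_inf_Q_def imp_eq_join imp_closed flip: w_def)
  qed
qed

text \<open>Apart from closure and the Boolean identity, the axioms are universal equations inherited from \<open>X\<close>.\<close>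

lemma boolean_subalgebraI:
  assumes sub: "B \<subseteq> X" and bounds: "\<zero> \<in> B" "\<one> \<in> B"
    and closed: "\<And>x y. x \<in> B \<Longrightarrow> y \<in> B \<Longrightarrow> x \<rightarrow> y \<in> B"
    and bool: "\<And>x y. x \<in> B \<Longrightarrow> y \<in> B \<Longrightarrow> (star y \<rightarrow> x) \<rightarrow> y = x \<rightarrow> y"
  shows "implicative_boolean_subalgebra B X imp one zero"
proof -
  have "implicative_boolean_algebra B imp one zero"
  proof unfold_locales
    fix x y z
    assume "x \<in> B" "y \<in> B" "z \<in> B"
    then show "x \<rightarrow> (y \<rightarrow> z) = y \<rightarrow> (x \<rightarrow> z)"
      using sub by (intro exchange) auto
  qed (use sub bounds closed bool in
      \<open>auto simp: subset_iff imp_self imp_one one_imp zero_le implicative\<close>)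
  with assms show ?thesis
    by (simp add: implicative_boolean_subalgebra_def)
qed

text \<open>
  Since \<open>\<rightarrow>\<close> is expressed by \<open>\<squnion>\<close> and \<open>\<^sup>*\<close>, a map that respects these two carries every identity
  of Boolean algebras to its image, in particular \<open>- (q \<squnion> p) \<squnion> q = - p \<squnion> q\<close>.
\<close>

lemma boolean_range:
  fixes h :: "'b::boolean_algebra \<Rightarrow> 'a"
  assumes hX: "\<And>p. h p \<in> X"
    and h_bot: "h bot = \<zero>"
    and h_compl: "\<And>p. h (- p) = star (h p)"
    and h_sup: "\<And>p q. h (sup p q) = h p \<squnion> h q"
  shows "implicative_boolean_subalgebra (range h) X imp one zero"
proof (rule boolean_subalgebraI)
  have imp: "h p \<rightarrow> h q = h (sup (- p) q)" for p q
    by (simp add: h_compl h_sup imp_eq_join hX)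
  show "range h \<subseteq> X"
    using hX by auto
  show "\<zero> \<in> range h"
    using h_bot by (metis rangeI)
  have "h (- bot) = \<one>"
    by (simp only: h_compl h_bot star_zero)
  then show "\<one> \<in> range h"
    by (metis rangeI)
  show "x \<rightarrow> y \<in> range h" if "x \<in> range h" "y \<in> range h" for x y
    using that imp by auto
  show "(star y \<rightarrow> x) \<rightarrow> y = x \<rightarrow> y" if xy: "x \<in> range h" "y \<in> range h" for x y
  proof -
    obtain p q where "x = h p" "y = h q"
      using xy by blast
    moreover have "sup (- sup q p) q = sup (- p) q"
      by (simp add: sup_inf_distrib2)
    ultimately show ?thesis
      by (simp add: imp flip: h_compl)
  qed
qed

text \<open>
  Three elements each of which is the complement of the join of the other two are the atoms,
  some possibly zero, of a Boolean subalgebra. Subsets of \<open>{0, 1, 2}\<close> are represented by arbitrary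
  sets of natural numbers, of which only the membership of these three numbers counts.
\<close>

lemma orthogonal_partition_boolean:
  assumes X: "a \<in> X" "b \<in> X" "c \<in> X"
    and a: "star a = b \<squnion> c" and b: "star b = a \<squnion> c" and c: "star c = a \<squnion> b"
  obtains B where "implicative_boolean_subalgebra B X imp one zero" "a \<in> B" "b \<in> B"
proof -
  define part where "part d i P = (if i \<in> P then d else \<zero>)" for d and i :: nat and P
  define h where "h P = part a 0 P \<squnion> (part b 1 P \<squnion> part c 2 P)" for P
  have part_X: "part d i P \<in> X" if "d \<in> X" for d i P
    using that by (simp add: part_def zero_closed)
  have part_Un: "part d i (P \<union> Q) = part d i P \<squnion> part d i Q" if "d \<in> X" for d i P Q
    using that by (simp add: part_def zero_closed)
  have join3: "a \<squnion> (b \<squnion> c) = \<one>"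
    using X a by (metis join_star_self)
  have compl: "star (b \<squnion> c) = a" "star (a \<squnion> c) = b" "star (a \<squnion> b) = c"
    using X by (simp_all flip: a b c)
  have "implicative_boolean_subalgebra (range h) X imp one zero"
  proof (rule boolean_range)
    show "h P \<in> X" for P
      using X by (simp add: h_def part_X)
    show "h bot = \<zero>"
      by (simp add: h_def part_def zero_closed)
    show "h (- P) = star (h P)" for P
      using X by (simp add: h_def part_def zero_closed a b c join3 compl)
    show "h (sup P Q) = h P \<squnion> h Q" for P Q
      using X by (simp add: h_def part_Un part_X join_assoc join_left_commute)
  qed
  moreover have "h {0} = a" "h {1} = b"
    using X by (simp_all add: h_def part_def zero_closed)
  then have "a \<in> range h" "b \<in> range h"
    by (metis rangeI)+
  ultimately show ?thesis
    by (rule that)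
qed

end

theorem theorem5p14:
  fixes X :: "'a set" and imp :: "'a \<Rightarrow> 'a \<Rightarrow> 'a" and one zero :: 'a
  assumes "implicative_ortholattice X imp one zero"
  shows "implicative_orthomodular_lattice X imp one zero \<longleftrightarrow>
    (\<forall>x\<in>X. \<forall>y\<in>X. be_orthogonal imp zero x y \<longrightarrow>
      (\<exists>B. implicative_boolean_subalgebra B X imp one zero \<and> x \<in> B \<and> y \<in> B))"
proof -
  interpret implicative_ortholattice X imp one zero
    by (rule assms)
  show ?thesis
    unfolding orthomodular_iff_law
  proof (intro iffI ballI impI)
    fix x y
    assume law: "\<forall>u\<in>X. \<forall>v\<in>X. u \<squnion> v = v \<longrightarrow> u \<squnion> star (u \<squnion> star v) = v"
      and X: "x \<in> X" "y \<in> X" and "be_orthogonal imp zero x y"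
    then have y_le: "y \<squnion> star x = star x"
      by (simp add: orthogonal_iff join_commute)
    then have x_le: "x \<squnion> star y = star y"
      using star_antitone[of y "star x"] X by simp
    have "star x = y \<squnion> star (x \<squnion> y)"
      using law y_le X by (metis join_commute star_closed star_star)
    moreover have "star y = x \<squnion> star (x \<squnion> y)"
      using law x_le X by (metis star_closed star_star)
    ultimately show "\<exists>B. implicative_boolean_subalgebra B X imp one zero \<and> x \<in> B \<and> y \<in> B"
      using X orthogonal_partition_boolean[of x y "star (x \<squnion> y)"] by auto
  next
    fix u v
    assume orth: "\<forall>x\<in>X. \<forall>y\<in>X. be_orthogonal imp zero x y \<longrightarrow>
        (\<exists>B. implicative_boolean_subalgebra B X imp one zero \<and> x \<in> B \<and> y \<in> B)"
      and X: "u \<in> X" "v \<in> X" and le: "u \<squnion> v = v"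
    have "be_orthogonal imp zero (star v) u"
      using X le by (simp add: orthogonal_iff join_commute)
    then obtain B where B: "implicative_boolean_subalgebra B X imp one zero" "star v \<in> B" "u \<in> B"
      using orth X by (meson star_closed)
    then have "imp (imp (star u) (star v)) u = imp (star v) u"
      by (intro implicative_boolean_algebra.boolean[of B imp one zero])
        (auto simp: implicative_boolean_subalgebra_def)
    then have "star (u \<squnion> star v) \<squnion> u = v \<squnion> u"
      using X by (simp add: imp_eq_join imp_closed)
    then show "u \<squnion> star (u \<squnion> star v) = v"
      using X le by (simp add: join_commute)
  qed
qed

end
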